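(* In the steady state of the job-search process on the labor flow network $\mathbf{A}$ with investment probability $v$, separation probability $\lambda$ and hiring policies $\{h_i\}_{i=1}^N$, the average unemployment associated to every firm $i$ is $$U_i=\frac{\varphi\, h_i k_i}{1-(1-v)^{k_i}},$$ where, with $\bar{h}_{\Gamma_i}=\frac{1}{k_i}\sum_j\mathbf{A}_{ij}h_j$, $$\varphi = \frac{H}{\sum_{i=1}^N h_i \bar{h}_{\Gamma_i} k_i \left[ \frac{1}{\lambda} + \frac{1}{\bar{h}_{\Gamma_i} [1-(1-v)^{k_i}]} \right]}.$$
   Context: There are $N\ge 2$ firms $\{1,\dots,N\}$, the nodes of a labor flow network: a connected, undirected, unweighted graph without self-loops, with symmetric $0/1$ adjacency matrix $\mathbf{A}$. $\Gamma_i=\{j:\mathbf{A}_{ij}=1\}$ is the neighbor set of firm $i$ and $k_i=|\Gamma_i|$ its degree. Parameters: $v\in(0,1]$, $\lambda\in(0,1]$, and a hiring policy $h_i\in(0,1]$ for each firm. There are $H$ workers, acting independently of each other; every worker is at each time either employed at a firm or unemployed and associated to a firm (his or her last employer). Each period: (1) each firm independently receives an investment (is "open") with probability $v$; (2) each employed worker becomes unemployed with probability $\lambda$ and stays associated to the last employer; (3) each unemployed worker associated to $i$ (excluding newly separated ones) picks a firm $j$ uniformly at random from the set $\gamma_i\subseteq\Gamma_i$ of open neighbors of $i$ and becomes employed at $j$ with probability $h_j$; otherwise (including when $\gamma_i=\emptyset$) the worker remains unemployed and associated to $i$. Let $p_i(t)$ be the probability that a worker is employed at $i$ in period $t$, and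 $q_i(t)$ the probability that a worker is unemployed in period $t$ and associated to $i$. With $\Pr_i(\gamma)=v^{|\gamma|}(1-v)^{k_i-|\gamma|}$ for $\gamma\subseteq\Gamma_i$ (the probability that the set of open neighbors of $i$ is $\gamma$), they satisfy $$p_i(t) = (1-\lambda)p_i(t-1) + h_i \sum_{j \in \Gamma_i}q_j(t-1) \sum_{\gamma\subseteq\Gamma_j,\ i\in\gamma} \Pr{}_j(\gamma) \frac{1}{|\gamma|},$$ $$q_i(t) = \lambda p_i(t-1) + q_i(t-1) \left[ \sum_{\emptyset\neq\gamma\subseteq\Gamma_i} \Pr{}_i(\gamma) \frac{1}{|\gamma|} \sum_{j \in \gamma} (1-h_j) + \Pr{}_i(\emptyset) \right].$$ The steady state is the time-invariant solution $(p_i,q_i)_{i=1}^N$ with $\sum_i p_i+\sum_i q_i=1$. The steady-state average unemployment associated to firm $i$ (firm-specific unemployment) is the expected number of workers who are unemployed and associated to $i$ in the steady state, $U_i=Hq_i$. *)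

theory Defs
  imports "HOL-Probability.Probability"
begin

text \<open>
  Firms are the elements of a finite type \<open>'n\<close>, so \<open>N = CARD('n)\<close>.
\<close>

definition labor_flow_network :: "real ^ 'n ^ 'n \<Rightarrow> bool" where
  "labor_flow_network A \<longleftrightarrow>
     (\<forall>i j. A $ i $ j \<in> {0, 1}) \<and>
     transpose A = A \<and>
     (\<forall>i. A $ i $ i = 0) \<and>
     (\<forall>i j. (i, j) \<in> {(a, b). A $ a $ b = 1}\<^sup>*)"

definition nbrs :: "real ^ 'n ^ 'n \<Rightarrow> 'n \<Rightarrow> 'n set" where
  "nbrs A i = {j. A $ i $ j = 1}"

definition deg :: "real ^ 'n ^ 'n \<Rightarrow> 'n \<Rightarrow> nat" where
  "deg A i = card (nbrs A i)"

definition prob_open :: "real ^ 'n ^ 'n \<Rightarrow> real \<Rightarrow> 'n \<Rightarrow> 'n set \<Rightarrow> real" where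
  "prob_open A v i \<gamma> = v ^ card \<gamma> * (1 - v) ^ (deg A i - card \<gamma>)"

text \<open>
  One period of the dynamics: from the probabilities \<open>p\<close>, \<open>q\<close> of being employed at,
  respectively unemployed and associated to, each firm in period \<open>t - 1\<close> to those in period \<open>t\<close>.
\<close>

definition employed_step ::
    "real ^ 'n ^ 'n \<Rightarrow> real \<Rightarrow> real \<Rightarrow> ('n::finite \<Rightarrow> real) \<Rightarrow>
     ('n \<Rightarrow> real) \<Rightarrow> ('n \<Rightarrow> real) \<Rightarrow> 'n \<Rightarrow> real" where
  "employed_step A v lam h p q i =
     (1 - lam) * p i +
     h i * (\<Sum>j\<in>nbrs A i. q j *
       (\<Sum>\<gamma> | \<gamma> \<subseteq> nbrs A j \<and> i \<in> \<gamma>. prob_open A v j \<gamma> * (1 / real (card \<gamma>))))"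

definition unemployed_step ::
    "real ^ 'n ^ 'n \<Rightarrow> real \<Rightarrow> real \<Rightarrow> ('n::finite \<Rightarrow> real) \<Rightarrow>
     ('n \<Rightarrow> real) \<Rightarrow> ('n \<Rightarrow> real) \<Rightarrow> 'n \<Rightarrow> real" where
  "unemployed_step A v lam h p q i =
     lam * p i +
     q i * ((\<Sum>\<gamma> | \<gamma> \<noteq> {} \<and> \<gamma> \<subseteq> nbrs A i.
               prob_open A v i \<gamma> * (1 / real (card \<gamma>)) * (\<Sum>j\<in>\<gamma>. 1 - h j))
            + prob_open A v i {})"

definition steady_state ::
    "real ^ 'n ^ 'n \<Rightarrow> real \<Rightarrow> real \<Rightarrow> ('n::finite \<Rightarrow> real) \<Rightarrow>
     ('n \<Rightarrow> real) \<Rightarrow> ('n \<Rightarrow> real) \<Rightarrow> bool" where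
  "steady_state A v lam h p q \<longleftrightarrow>
     (\<forall>i. p i = employed_step A v lam h p q i) \<and>
     (\<forall>i. q i = unemployed_step A v lam h p q i) \<and>
     (\<Sum>i\<in>UNIV. p i) + (\<Sum>i\<in>UNIV. q i) = 1"

datatype 'n worker_state = Employed 'n | Unemployed 'n

text \<open>
  The law of a single worker's state. It is meaningful only if \<open>p\<close> and \<open>q\<close> are nonnegative
  with total mass 1; nonnegativity is not imposed in \<open>steady_state\<close>, but it holds for the
  (unique) steady state.
\<close>

definition worker_pmf :: "('n \<Rightarrow> real) \<Rightarrow> ('n \<Rightarrow> real) \<Rightarrow> 'n worker_state pmf" where
  "worker_pmf p q = embed_pmf (case_worker_state p q)"

text \<open>
  Expected number, among \<open>H\<close> independent workers, of those unemployed and associated to \<open>i\<close>.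
  The value \<open>undefined\<close> is the state given by \<open>Pi_pmf\<close> to indices outside \<open>{..<H}\<close>
  and plays no role.
\<close>

definition firm_unemployment ::
    "nat \<Rightarrow> ('n \<Rightarrow> real) \<Rightarrow> ('n \<Rightarrow> real) \<Rightarrow> 'n \<Rightarrow> real" where
  "firm_unemployment H p q i =
     measure_pmf.expectation (Pi_pmf {..<H} undefined (\<lambda>_. worker_pmf p q))
       (\<lambda>\<omega>. real (card {w \<in> {..<H}. \<omega> w = Unemployed i}))"

lemma pmf_worker_pmf:
  fixes p q :: "'n::finite \<Rightarrow> real"
  assumes "\<And>i. p i \<ge> 0" "\<And>i. q i \<ge> 0"
    and "(\<Sum>i\<in>UNIV. p i) + (\<Sum>i\<in>UNIV. q i) = 1"
  shows "pmf (worker_pmf p q) s = case_worker_state p q s"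
  unfolding worker_pmf_def
proof (rule pmf_embed_pmf)
  show nn: "0 \<le> case_worker_state p q s" for s
    using assms by (cases s) auto
  have U: "(UNIV :: 'n worker_state set) = range Employed \<union> range Unemployed"
  proof (rule UNIV_eq_I)
    show "s \<in> range Employed \<union> range Unemployed" for s :: "'n worker_state"
      by (cases s) auto
  qed
  have fin: "finite (UNIV :: 'n worker_state set)" unfolding U by simp
  have "(\<Sum>s\<in>UNIV. case_worker_state p q s) =
      (\<Sum>s\<in>range Employed. case_worker_state p q s) +
      (\<Sum>s\<in>range Unemployed. case_worker_state p q s)"
    unfolding U by (rule sum.union_disjoint) auto
  also have "\<dots> = (\<Sum>i\<in>UNIV. p i) + (\<Sum>i\<in>UNIV. q i)"
    by (simp add: sum.reindex inj_def)
  finally have "(\<Sum>s\<in>UNIV. case_worker_state p q s) = 1"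
    using assms(3) by (rule trans)
  then show "(\<integral>\<^sup>+ s. ennreal (case_worker_state p q s) \<partial>count_space UNIV) = 1"
    by (simp only: nn_integral_count_space_finite[OF fin] sum_ennreal[OF nn] ennreal_1)
qed

lemma firm_unemployment_eq:
  fixes p q :: "'n::finite \<Rightarrow> real"
  assumes "\<And>i. p i \<ge> 0" "\<And>i. q i \<ge> 0"
    and "(\<Sum>i\<in>UNIV. p i) + (\<Sum>i\<in>UNIV. q i) = 1"
  shows "firm_unemployment H p q i = real H * q i"
proof -
  let ?M = "Pi_pmf {..<H} undefined (\<lambda>_. worker_pmf p q)"
  have card: "real (card {w \<in> {..<H}. \<omega> w = Unemployed i}) =
      (\<Sum>w<H. indicator {\<omega>. \<omega> w = Unemployed i} \<omega>)" for \<omega> :: "nat \<Rightarrow> 'n worker_state"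
    by (simp only: card_eq_sum sum.inter_filter[OF finite_lessThan] of_nat_sum
        indicator_def mem_Collect_eq of_nat_1 of_nat_0 if_distrib[of real] of_bool_def)
  have comp: "measure_pmf.prob ?M {\<omega>. \<omega> w = Unemployed i} = q i" if "w < H" for w
  proof -
    have "measure_pmf.prob ?M {\<omega>. \<omega> w = Unemployed i} =
        pmf (map_pmf (\<lambda>\<omega>. \<omega> w) ?M) (Unemployed i)"
      by (simp add: pmf_map vimage_def)
    then show ?thesis
      using that by (simp add: Pi_pmf_component pmf_worker_pmf[OF assms])
  qed
  have int: "integrable ?M (indicator {\<omega>. \<omega> w = Unemployed i} :: _ \<Rightarrow> real)" for w
    by (rule measure_pmf.integrable_const_bound[where B = 1]) (auto simp: indicator_def)
  have "firm_unemployment H p q i = (\<Sum>w<H. measure_pmf.prob ?M {\<omega>. \<omega> w = Unemployed i})"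
    unfolding firm_unemployment_def card
    by (subst Bochner_Integration.integral_sum) (simp_all add: int)
  also have "\<dots> = (\<Sum>w<H. q i)"
    using comp by (intro sum.cong) simp_all
  finally show ?thesis
    by simp
qed

definition avg_nbr_hiring :: "real ^ 'n ^ 'n \<Rightarrow> ('n::finite \<Rightarrow> real) \<Rightarrow> 'n \<Rightarrow> real" where
  "avg_nbr_hiring A h i = (1 / real (deg A i)) * (\<Sum>j\<in>UNIV. A $ i $ j * h j)"

definition phi ::
    "real ^ 'n ^ 'n \<Rightarrow> real \<Rightarrow> real \<Rightarrow> ('n::finite \<Rightarrow> real) \<Rightarrow> nat \<Rightarrow> real" where
  "phi A v lam h H =
     real H /
     (\<Sum>i\<in>UNIV. h i * avg_nbr_hiring A h i * real (deg A i) *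
        (1 / lam + 1 / (avg_nbr_hiring A h i * (1 - (1 - v) ^ deg A i))))"

end

theory Submission
  imports Defs
begin

text \<open>
  By symmetry, an unemployed worker associated to \<open>j\<close> picks each neighbor of \<open>j\<close> with the same
  probability \<open>D j / k j\<close>, where \<open>k j\<close> is the degree and \<open>D j = 1 - (1 - v) ^ k j\<close>. With
  \<open>hb i\<close> the average hiring policy of the neighbors of \<open>i\<close>, the steady-state equations become
  \<open>lam * p i = q i * D i * hb i\<close> and \<open>lam * p i = h i * (\<Sum>j\<in>nbrs A i. q j * D j / k j)\<close>. In
  terms of \<open>x i = q i * D i / (h i * k i)\<close> they say that \<open>x\<close> is harmonic for the edge weights
  \<open>h i * h j\<close>, so \<open>x\<close> is constant by the maximum principle on a connected graph, and the
  normalization determines the constant.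
\<close>

section \<open>Sums over the subsets of a finite set\<close>

lemma sum_subsets_containing_swap:
  fixes g :: "'a set \<Rightarrow> real" and f :: "'a \<Rightarrow> real"
  assumes "finite B"
  shows "(\<Sum>\<gamma> | \<gamma> \<noteq> {} \<and> \<gamma> \<subseteq> B. g \<gamma> * (\<Sum>j\<in>\<gamma>. f j)) =
         (\<Sum>j\<in>B. f j * (\<Sum>\<gamma> | \<gamma> \<subseteq> B \<and> j \<in> \<gamma>. g \<gamma>))"
proof -
  let ?P = "{\<gamma>. \<gamma> \<noteq> {} \<and> \<gamma> \<subseteq> B}"
  have fin: "finite ?P"
    by (rule finite_subset[of _ "Pow B"]) (use assms in auto)
  have "(\<Sum>\<gamma>\<in>?P. g \<gamma> * (\<Sum>j\<in>\<gamma>. f j)) = (\<Sum>\<gamma>\<in>?P. \<Sum>j | j \<in> B \<and> j \<in> \<gamma>. f j * g \<gamma>)"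
  proof (rule sum.cong[OF refl])
    fix \<gamma> assume "\<gamma> \<in> ?P"
    then have "{j. j \<in> B \<and> j \<in> \<gamma>} = \<gamma>" by auto
    then show "g \<gamma> * (\<Sum>j\<in>\<gamma>. f j) = (\<Sum>j | j \<in> B \<and> j \<in> \<gamma>. f j * g \<gamma>)"
      by (simp add: sum_distrib_left mult.commute)
  qed
  also have "\<dots> = (\<Sum>j\<in>B. \<Sum>\<gamma> | \<gamma> \<in> ?P \<and> j \<in> \<gamma>. f j * g \<gamma>)"
    by (rule sum.swap_restrict[OF fin assms])
  also have "\<dots> = (\<Sum>j\<in>B. f j * (\<Sum>\<gamma> | \<gamma> \<subseteq> B \<and> j \<in> \<gamma>. g \<gamma>))"
    unfolding sum_distrib_left by (intro sum.cong) auto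
  finally show ?thesis .
qed

text \<open>Transposing \<open>i\<close> and \<open>j\<close> preserves cardinality and exchanges
  the subsets of \<open>B\<close> that contain \<open>i\<close> with those that contain
  \<open>j\<close>.\<close>

lemma sum_subsets_containing_card_eq:
  fixes f :: "nat \<Rightarrow> real"
  assumes "i \<in> B" "j \<in> B"
  shows "(\<Sum>\<gamma> | \<gamma> \<subseteq> B \<and> i \<in> \<gamma>. f (card \<gamma>)) = (\<Sum>\<gamma> | \<gamma> \<subseteq> B \<and> j \<in> \<gamma>. f (card \<gamma>))"
proof -
  let ?T = "\<lambda>\<gamma>. Transposition.transpose i j ` \<gamma>"
  have B: "?T B = B"
    using assms by simp
  have TT: "?T (?T \<gamma>) = \<gamma>" for \<gamma>
    by (simp add: image_image)
  have sub: "?T \<gamma> \<subseteq> B" if "\<gamma> \<subseteq> B" for \<gamma>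
    using image_mono[OF that, of "Transposition.transpose i j"] B by simp
  have ij: "j \<in> ?T \<gamma>" if "i \<in> \<gamma>" for \<gamma>
    using that by (metis image_eqI transpose_apply_first)
  have ji: "i \<in> ?T \<gamma>" if "j \<in> \<gamma>" for \<gamma>
    using that by (metis image_eqI transpose_apply_second)
  show ?thesis
    by (rule sum.reindex_bij_witness[of _ ?T ?T])
      (use TT sub ij ji in \<open>auto simp: card_image\<close>)
qed

text \<open>Each nonempty subset splits its weight evenly among its elements. By symmetry all
  elements of \<open>B\<close> collect equal shares of the total.\<close>

lemma sum_subsets_containing_card:
  fixes f :: "nat \<Rightarrow> real"
  assumes "finite B" "i \<in> B"
  shows "(\<Sum>\<gamma> | \<gamma> \<subseteq> B \<and> i \<in> \<gamma>. f (card \<gamma>) * (1 / real (card \<gamma>))) =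
         (\<Sum>\<gamma> | \<gamma> \<noteq> {} \<and> \<gamma> \<subseteq> B. f (card \<gamma>)) / real (card B)"
proof -
  let ?S = "\<lambda>i. \<Sum>\<gamma> | \<gamma> \<subseteq> B \<and> i \<in> \<gamma>. f (card \<gamma>) * (1 / real (card \<gamma>))"
  have "(\<Sum>\<gamma> | \<gamma> \<noteq> {} \<and> \<gamma> \<subseteq> B. f (card \<gamma>)) =
      (\<Sum>\<gamma> | \<gamma> \<noteq> {} \<and> \<gamma> \<subseteq> B. f (card \<gamma>) * (1 / real (card \<gamma>)) * (\<Sum>j\<in>\<gamma>. 1))"
    by (intro sum.cong refl) (use assms(1) in \<open>auto simp: card_eq_0_iff dest: finite_subset\<close>)
  also have "\<dots> = (\<Sum>j\<in>B. ?S j)"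
    using sum_subsets_containing_swap[OF assms(1),
        of "\<lambda>\<gamma>. f (card \<gamma>) * (1 / real (card \<gamma>))" "\<lambda>_. 1"] by simp
  also have "\<dots> = (\<Sum>j\<in>B. ?S i)"
    by (rule sum.cong[OF refl],
        rule sum_subsets_containing_card_eq[where f = "\<lambda>n. f n * (1 / real n)", OF _ assms(2)])
  also have "\<dots> = real (card B) * ?S i"
    by simp
  finally show ?thesis
    using assms by (auto simp: field_simps card_eq_0_iff)
qed

text \<open>Maximum principle: at a maximizer the summands are nonnegative with sum 0, so all its
  neighbors are maximizers too, and connectivity spreads this everywhere. The weight depends on the
  target alone: for edge weights \<open>h i * h j\<close> the factor \<open>h i\<close>
  cancels.\<close>

lemma harmonic_constant:
  fixes x :: "'n::finite \<Rightarrow> real" and w :: "'n \<Rightarrow> real"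
  assumes conn: "\<And>i j. (i, j) \<in> E\<^sup>*"
    and w: "\<And>i. w i > 0"
    and harm: "\<And>i. (\<Sum>j | (i, j) \<in> E. w j * (x i - x j)) = 0"
  shows "x i = x j"
proof -
  have "Max (range x) \<in> range x" by (rule Max_in) auto
  then obtain m where m: "Max (range x) = x m" by (rule rangeE)
  have le: "x k \<le> x m" for k
    unfolding m[symmetric] by simp
  have max: "x k = x m" for k
    using conn[of m k]
  proof (induction rule: rtrancl_induct)
    case (step y z)
    have "\<forall>j\<in>{j. (y, j) \<in> E}. w j * (x y - x j) = 0"
      using harm[of y] step.IH le less_imp_le[OF w]
      by (subst sum_nonneg_eq_0_iff[symmetric]) auto
    then show ?case
      using step w[of z] by auto
  qed simp
  show ?thesis
    using max by metis
qed

section \<open>The dynamics in reduced form\<close>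

locale job_search =
  fixes A :: "real ^ 'n ^ 'n" and v lam :: real and h :: "'n \<Rightarrow> real"
  assumes two_firms: "CARD('n) \<ge> 2"
    and network: "labor_flow_network A"
    and v: "0 < v" "v \<le> 1"
    and lam: "0 < lam"
    and h_pos: "\<And>i. 0 < h i"
begin

abbreviation "k i \<equiv> real (deg A i)"
abbreviation "hb \<equiv> avg_nbr_hiring A h"
abbreviation "D i \<equiv> 1 - (1 - v) ^ deg A i"
text \<open>This normalizes the law of a single worker; \<open>phi A v lam h H\<close> is
  \<open>real H * c\<close>.\<close>

abbreviation "c \<equiv> phi A v lam h 1"

lemma nbrs_sym: "j \<in> nbrs A i \<longleftrightarrow> i \<in> nbrs A j"
proof -
  have "Finite_Cartesian_Product.transpose A = A"
    using network by (simp add: labor_flow_network_def)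
  then have "A $ i $ j = A $ j $ i"
    by (metis transpose_def vec_lambda_beta)
  then show ?thesis by (simp add: nbrs_def)
qed

lemma nbrs_nonempty: "nbrs A i \<noteq> {}"
proof -
  have "UNIV \<noteq> {i}"
    using two_firms by (metis card_1_singleton_iff One_nat_def Suc_1 not_less_eq_eq le_refl)
  then obtain j where j: "j \<noteq> i" by auto
  have "(i, j) \<in> {(a, b). A $ a $ b = 1}\<^sup>*"
    using network by (simp add: labor_flow_network_def)
  then show ?thesis
    using j by (cases rule: converse_rtranclE) (auto simp: nbrs_def)
qed

lemma k_pos: "k i > 0"
  using nbrs_nonempty by (simp add: deg_def card_gt_0_iff)

lemma D_pos: "D i > 0"
  \<comment> \<open>For v = 1 the power is 0 because the degree is positive; otherwise the base lies
    strictly between 0 and 1.\<close>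
  using power_Suc_less_one[of "1 - v" "deg A i - 1"] k_pos[of i] v
  by (cases "v = 1") (auto simp: zero_power)

lemma nbr_hiring_eq: "(\<Sum>j\<in>nbrs A i. h j) = k i * hb i"
proof -
  have "(\<Sum>j\<in>UNIV. A $ i $ j * h j) = (\<Sum>j\<in>UNIV. if j \<in> nbrs A i then h j else 0)"
    using network by (intro sum.cong) (auto simp: labor_flow_network_def nbrs_def)
  then show ?thesis
    using k_pos[of i] by (simp add: avg_nbr_hiring_def sum.If_cases)
qed

lemma hb_pos: "hb i > 0"
proof -
  have "0 < (\<Sum>j\<in>nbrs A i. h j)"
    using nbrs_nonempty h_pos by (intro sum_pos) auto
  then show ?thesis
    unfolding nbr_hiring_eq using k_pos[of i] by (simp add: zero_less_mult_iff)
qed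

text \<open>Expanding the product of the factors v + (1 - v) over all neighbors shows that the
  probabilities of all subsets add up to 1. The empty set accounts for
  \<open>(1 - v) ^ deg A i\<close>.\<close>

lemma sum_prob_open_nonempty: "(\<Sum>\<gamma> | \<gamma> \<noteq> {} \<and> \<gamma> \<subseteq> nbrs A i. prob_open A v i \<gamma>) = D i"
proof -
  have "(\<Sum>\<gamma>\<in>Pow (nbrs A i). prob_open A v i \<gamma>) =
      (\<Sum>\<gamma>\<in>Pow (nbrs A i). (\<Prod>j\<in>\<gamma>. v) * (\<Prod>j\<in>nbrs A i - \<gamma>. 1 - v))"
    by (intro sum.cong) (auto simp: prob_open_def deg_def card_Diff_subset)
  also have "\<dots> = (\<Prod>j\<in>nbrs A i. v + (1 - v))"
    by (rule prod_add[symmetric]) simp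
  finally have "(\<Sum>\<gamma>\<in>Pow (nbrs A i). prob_open A v i \<gamma>) = 1" by simp
  moreover have "Pow (nbrs A i) = insert {} {\<gamma>. \<gamma> \<noteq> {} \<and> \<gamma> \<subseteq> nbrs A i}" by auto
  ultimately show ?thesis by (simp add: prob_open_def)
qed

text \<open>\<open>prob_open\<close> depends on the set only through its cardinality, so the
  symmetry argument applies.\<close>

lemma find_prob:
  assumes "j \<in> nbrs A i"
  shows "(\<Sum>\<gamma> | \<gamma> \<subseteq> nbrs A i \<and> j \<in> \<gamma>. prob_open A v i \<gamma> * (1 / real (card \<gamma>))) = D i / k i"
  using sum_subsets_containing_card[OF _ assms, of "\<lambda>n. v ^ n * (1 - v) ^ (deg A i - n)"]
    sum_prob_open_nonempty[of i]
  by (simp add: prob_open_def flip: deg_def)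

lemma employed_step_eq:
  "employed_step A v lam h p q i =
     (1 - lam) * p i + h i * (\<Sum>j\<in>nbrs A i. q j * (D j / k j))"
  unfolding employed_step_def
  by (intro arg_cong2[where f = "(+)"] arg_cong2[where f = "(*)"] sum.cong refl find_prob)
    (simp add: nbrs_sym)

lemma unemployed_step_eq:
  "unemployed_step A v lam h p q i = lam * p i + q i * (1 - D i * hb i)"
proof -
  let ?g = "\<lambda>\<gamma>. prob_open A v i \<gamma> * (1 / real (card \<gamma>))"
  have "(\<Sum>\<gamma> | \<gamma> \<noteq> {} \<and> \<gamma> \<subseteq> nbrs A i. ?g \<gamma> * (\<Sum>j\<in>\<gamma>. 1 - h j)) =
      (\<Sum>j\<in>nbrs A i. (1 - h j) * (\<Sum>\<gamma> | \<gamma> \<subseteq> nbrs A i \<and> j \<in> \<gamma>. ?g \<gamma>))"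
    by (rule sum_subsets_containing_swap) simp
  also have "\<dots> = (\<Sum>j\<in>nbrs A i. (1 - h j) * (D i / k i))"
    by (intro sum.cong refl arg_cong2[where f = "(*)"] find_prob)
  also have "\<dots> = (k i - k i * hb i) * (D i / k i)"
    by (simp only: sum_distrib_right[symmetric] sum_subtractf nbr_hiring_eq) (simp add: deg_def)
  also have "\<dots> = D i - D i * hb i"
    using k_pos[of i] by (simp add: field_simps)
  \<comment> \<open>The remaining term \<open>prob_open A v i {}\<close> equals
    \<open>1 - D i\<close>, which cancels the leading \<open>D i\<close>.\<close>
  finally show ?thesis
    by (simp add: unemployed_step_def prob_open_def)
qed

section \<open>The steady state and its unemployment\<close>

lemma phi_pos: "c > 0"
  unfolding phi_def using h_pos hb_pos k_pos D_pos lam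
  by (intro divide_pos_pos sum_pos mult_pos_pos add_pos_pos) auto

lemma steady_state_iff:
  "steady_state A v lam h p q \<longleftrightarrow>
     p = (\<lambda>i. c * h i * k i * hb i / lam) \<and> q = (\<lambda>i. c * h i * k i / D i)"
  (is "?L \<longleftrightarrow> p = ?p \<and> q = ?q")
proof -
  have fixpoint: "?L \<longleftrightarrow>
      (\<forall>i. lam * p i = h i * (\<Sum>j\<in>nbrs A i. q j * (D j / k j))) \<and>
      (\<forall>i. lam * p i = q i * (D i * hb i)) \<and>
      (\<Sum>i\<in>UNIV. p i) + (\<Sum>i\<in>UNIV. q i) = 1"
    unfolding steady_state_def employed_step_eq unemployed_step_eq
  proof (intro arg_cong2[where f = "(\<and>)"] all_cong1 refl)
    show "p i = (1 - lam) * p i + s \<longleftrightarrow> lam * p i = s" for i s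
      by (auto simp: left_diff_distrib)
    show "q i = lam * p i + q i * (1 - d) \<longleftrightarrow> lam * p i = q i * d" for i d
      by (auto simp: right_diff_distrib)
  qed
  \<comment> \<open>The total mass is needed for an arbitrary scale \<open>a\<close>: normalization
    then forces \<open>a = c\<close> in one direction, and \<open>a = c\<close> gives mass 1 in the
    other.\<close>
  have total: "(\<Sum>i\<in>UNIV. a * h i * k i * hb i / lam) + (\<Sum>i\<in>UNIV. a * h i * k i / D i) = a / c"
    for a
  proof -
    have "(\<Sum>i\<in>UNIV. a * h i * k i * hb i / lam) + (\<Sum>i\<in>UNIV. a * h i * k i / D i) =
        a * (\<Sum>i\<in>UNIV. h i * hb i * k i * (1 / lam + 1 / (hb i * D i)))"
      unfolding sum.distrib[symmetric] sum_distrib_left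
    proof (intro sum.cong refl)
      fix i
      show "a * h i * k i * hb i / lam + a * h i * k i / D i =
          a * (h i * hb i * k i * (1 / lam + 1 / (hb i * D i)))"
        using hb_pos[of i] by (simp add: distrib_left mult_ac)
    qed
    then show ?thesis by (simp add: phi_def)
  qed
  show ?thesis
  proof
    assume ?L
    then have emp: "lam * p i = h i * (\<Sum>j\<in>nbrs A i. q j * (D j / k j))"
      and unemp: "lam * p i = q i * (D i * hb i)"
      and norm: "(\<Sum>i\<in>UNIV. p i) + (\<Sum>i\<in>UNIV. q i) = 1" for i
      unfolding fixpoint by blast+
    \<comment> \<open>The flow of hires from \<open>j\<close> to a neighbor \<open>i\<close> is
      \<open>h i * q j * (D j / k j)\<close>, that is, \<open>h i * h j * x j\<close>. Constant
      \<open>x\<close> thus means that the flows along each edge balance.\<close>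
    define x where "x i = q i * D i / (h i * k i)" for i
    have q_x: "q i * (D i / k i) = h i * x i" for i
      using h_pos[of i] by (simp add: x_def)
    have "(\<Sum>j | (i, j) \<in> {(a, b). A $ a $ b = 1}. h j * (x i - x j)) = 0" for i
    proof -
      \<comment> \<open>Hires into firm \<open>i\<close> equal hires out of its unemployed pool,
        since both match the separations \<open>lam * p i\<close>.\<close>
      have "h i * (\<Sum>j\<in>nbrs A i. h j * x j) = q i * (D i * hb i)"
        using emp[of i] unemp[of i] by (simp only: q_x)
      also have "\<dots> = q i * (D i / k i) * (k i * hb i)"
        using k_pos[of i] by simp
      also have "\<dots> = h i * x i * (\<Sum>j\<in>nbrs A i. h j)"
        by (simp only: q_x nbr_hiring_eq)
      finally have "(\<Sum>j\<in>nbrs A i. h j * x j) = x i * (\<Sum>j\<in>nbrs A i. h j)"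
        using h_pos[of i] by simp
      then show ?thesis
        by (simp add: right_diff_distrib sum_subtractf sum_distrib_left mult.commute flip: nbrs_def)
    qed
    then have const: "x i = x j" for i j
      using network h_pos
      by (intro harmonic_constant[where w = h and E = "{(a, b). A $ a $ b = 1}"])
        (auto simp: labor_flow_network_def)
    \<comment> \<open>\<open>undefined\<close> stands for an arbitrary firm; the choice is
      immaterial as \<open>x\<close> is constant.\<close>
    define a where "a = x undefined"
    have q: "q i = a * h i * k i / D i" for i
    proof -
      have "q i * (D i / k i) = h i * a"
        using q_x[of i] const[of i undefined] by (simp only: a_def)
      then have "q i * D i = a * h i * k i"
        using k_pos[of i] by (simp add: divide_eq_eq mult_ac)
      then show ?thesis
        using D_pos[of i] by (simp only: eq_divide_eq) simp
    qed
    have p: "p i = a * h i * k i * hb i / lam" for i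
    proof -
      have "lam * p i = a * h i * k i * hb i"
        using unemp[of i] D_pos[of i] unfolding q by simp
      then show ?thesis
        using lam by (simp add: eq_divide_eq mult.commute)
    qed
    have "a / c = 1"
      using norm unfolding p q total .
    then have "a = c"
      using phi_pos by simp
    with p q show "p = ?p \<and> q = ?q" by auto
  next
    assume "p = ?p \<and> q = ?q"
    moreover have "?q j * (D j / k j) = c * h j" for j
      using k_pos[of j] D_pos[of j] by simp
    moreover have "(\<Sum>j\<in>nbrs A i. c * h j) = c * (k i * hb i)" for i
      by (simp add: nbr_hiring_eq flip: sum_distrib_left)
    moreover have "?q i * (D i * hb i) = c * h i * k i * hb i" for i
      using D_pos[of i] by simp
    moreover have "(\<Sum>i\<in>UNIV. ?p i) + (\<Sum>i\<in>UNIV. ?q i) = 1"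
      using total[of c] phi_pos by simp
    ultimately show ?L
      using lam unfolding fixpoint by simp
  qed
qed

lemma firm_unemployment_steady_state:
  assumes "steady_state A v lam h p q"
  shows "firm_unemployment H p q i = phi A v lam h H * h i * k i / D i"
proof -
  have pq: "p = (\<lambda>i. c * h i * k i * hb i / lam)" "q = (\<lambda>i. c * h i * k i / D i)"
    using assms by (simp_all add: steady_state_iff)
  \<comment> \<open>Nonnegativity comes from the explicit solution; it makes
    \<open>worker_pmf p q\<close> the law with masses \<open>p\<close> and \<open>q\<close>.\<close>
  have "p i \<ge> 0" for i
    unfolding pq using phi_pos h_pos[of i] hb_pos[of i] lam by simp
  moreover have "q i \<ge> 0" for i
    unfolding pq using phi_pos h_pos[of i] D_pos[of i] by simp
  moreover have "(\<Sum>i\<in>UNIV. p i) + (\<Sum>i\<in>UNIV. q i) = 1"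
    using assms unfolding steady_state_def by blast
  ultimately have "firm_unemployment H p q i = real H * q i"
    by (rule firm_unemployment_eq)
  then show ?thesis
    by (simp add: pq phi_def)
qed

end

theorem proposition4:
  fixes A :: "real ^ 'n ^ 'n" and v lam :: real and h :: "'n \<Rightarrow> real" and H :: nat
  assumes "CARD('n) \<ge> 2"
    and "labor_flow_network A"
    and "0 < v" "v \<le> 1"
    and "0 < lam" "lam \<le> 1"
    and "\<And>i. 0 < h i" "\<And>i. h i \<le> 1"
  shows "(\<exists>!s. steady_state A v lam h (fst s) (snd s)) \<and>
         (\<forall>p q. steady_state A v lam h p q \<longrightarrow>
            (\<forall>i. firm_unemployment H p q i =
                  phi A v lam h H * h i * real (deg A i) / (1 - (1 - v) ^ deg A i)))"
proof -
  interpret job_search A v lam h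
    using assms by unfold_locales
  show ?thesis
    using firm_unemployment_steady_state by (auto simp: steady_state_iff prod_eq_iff)
qed

end
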